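(* Let $X$ be a nonempty set. Then $\mathsf{N}_{\mathrm{sb}}[X]=(\mathbb{N}_{\mathrm{sb}}[X],+,\times,0,1)$ is a free strong bimonoid, freely generated (in the class of all strong bimonoids) by the set $X/\mathrm{AC}=\{[x]_{\mathrm{AC}}\mid x\in X\}$.
   Context: A strong bimonoid is an algebra $(B,\oplus,\otimes,\mathbf 0,\mathbf 1)$ such that $(B,\oplus,\mathbf 0)$ is a commutative monoid, $(B,\otimes,\mathbf 1)$ is a monoid, and $b\otimes\mathbf 0=\mathbf 0\otimes b=\mathbf 0$ for all $b$. Homomorphisms preserve both operations and both constants. An algebra $F$ in a class $\mathcal K$ is freely generated in $\mathcal K$ by $Y\subseteq F$ if $Y$ generates $F$ (using the operations and constants) and every map $Y\to A$ with $A\in\mathcal K$ extends to a homomorphism $F\to A$. $\mathrm{T}(X)$ is the set of all terms built from elements of $X$, constants $\hat 0,\hat 1$, and binary symbols $\hat+,\hat\times$ (infix). A term $s$ is simple if $s=\hat 0$, or $s$ contains neither $\hat 0$ nor any subterm of the form $\hat 1\hat\times s'$ or $s'\hat\times\hat 1$; $\mathrm{ST}(X)$ is the set of simple terms. For $s,t\in \mathrm{ST}(X)$, $s=_{\mathrm{AC}}t$ means that $t$ is obtained from $s$ by finitely many steps, each replacing a subterm occurrence using, in either direction, one of: $a\hat+(b\hat+c)\leftrightarrow(a\hat+b)\hat+c$, $a\hat+b\leftrightarrow b\hat+a$, $a\hat\times(b\hat\times c)\leftrightarrow(a\hat\times b)\hat\times c$. $[s]_{\mathrm{AC}}$ is the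 class of $s$; $\mathbb{N}_{\mathrm{sb}}[X]=\mathrm{ST}(X)/{=_{\mathrm{AC}}}$; $0=[\hat 0]_{\mathrm{AC}}$, $1=[\hat 1]_{\mathrm{AC}}$. Operations: $p+0=0+p=p$, and $[s]_{\mathrm{AC}}+[t]_{\mathrm{AC}}=[s\hat+t]_{\mathrm{AC}}$ for $s,t\neq\hat 0$; $p\times 0=0\times p=0$, $p\times1=1\times p=p$, and $[s]_{\mathrm{AC}}\times[t]_{\mathrm{AC}}=[s\hat\times t]_{\mathrm{AC}}$ for $s,t\notin\{\hat 0,\hat 1\}$. *)

theory Defs
  imports "HOL-Algebra.Ring"
begin

section \<open>Strong bimonoids\<close>

text \<open>Algebras with two binary operations and two constants are represented by the record
  of \<^theory>\<open>HOL-Algebra.Ring\<close>.\<close>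

locale strong_bimonoid = abelian_monoid R + monoid R for R (structure) +
  assumes zero_mult: "b \<in> carrier R \<Longrightarrow> \<zero> \<otimes> b = \<zero>"
    and mult_zero: "b \<in> carrier R \<Longrightarrow> b \<otimes> \<zero> = \<zero>"

text \<open>Without additive inverses, membership in \<^const>\<open>ring_hom\<close> does not imply that zero is
  preserved.\<close>

definition sb_hom :: "('a, 'm) ring_scheme \<Rightarrow> ('b, 'n) ring_scheme \<Rightarrow> ('a \<Rightarrow> 'b) set" where
  "sb_hom R S = {h \<in> ring_hom R S. h \<zero>\<^bsub>R\<^esub> = \<zero>\<^bsub>S\<^esub>}"

inductive_set sb_generate :: "('a, 'm) ring_scheme \<Rightarrow> 'a set \<Rightarrow> 'a set"
  for R :: "('a, 'm) ring_scheme" and Y :: "'a set" where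
  gen: "y \<in> Y \<Longrightarrow> y \<in> sb_generate R Y"
| zero: "\<zero>\<^bsub>R\<^esub> \<in> sb_generate R Y"
| one: "\<one>\<^bsub>R\<^esub> \<in> sb_generate R Y"
| add: "a \<in> sb_generate R Y \<Longrightarrow> b \<in> sb_generate R Y \<Longrightarrow> a \<oplus>\<^bsub>R\<^esub> b \<in> sb_generate R Y"
| mult: "a \<in> sb_generate R Y \<Longrightarrow> b \<in> sb_generate R Y \<Longrightarrow> a \<otimes>\<^bsub>R\<^esub> b \<in> sb_generate R Y"

text \<open>HOL has no quantification over types, so the class \<open>K\<close> is a predicate on the
  algebras whose elements have some type \<open>'c\<close>. A statement about
  \<open>freely_generated_in (K :: 'c ring \<Rightarrow> bool)\<close> with \<open>'c\<close> a type variable and \<open>K\<close> polymorphic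
  ranges over the algebras in \<open>K\<close> over every type. That \<open>F\<close> itself belongs to
  the class has to be stated separately, since the elements of \<open>F\<close> have another type.\<close>

definition freely_generated_in :: "('c ring \<Rightarrow> bool) \<Rightarrow> ('a, 'm) ring_scheme \<Rightarrow> 'a set \<Rightarrow> bool" where
  "freely_generated_in K F Y \<longleftrightarrow>
     Y \<subseteq> carrier F \<and>
     sb_generate F Y = carrier F \<and>
     (\<forall>A f. K A \<longrightarrow> f \<in> Y \<rightarrow> carrier A \<longrightarrow> (\<exists>h \<in> sb_hom F A. \<forall>y\<in>Y. h y = f y))"

section \<open>Simple terms\<close>

datatype (vars: 'x) sbterm =
    Var 'x
  | Zero
  | One
  | Plus "'x sbterm" "'x sbterm"
  | Times "'x sbterm" "'x sbterm"

definition terms_over :: "'x set \<Rightarrow> 'x sbterm set" where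
  "terms_over X = {t. vars t \<subseteq> X}"

primrec subterms :: "'x sbterm \<Rightarrow> 'x sbterm set" where
  "subterms (Var x) = {Var x}"
| "subterms Zero = {Zero}"
| "subterms One = {One}"
| "subterms (Plus s t) = insert (Plus s t) (subterms s \<union> subterms t)"
| "subterms (Times s t) = insert (Times s t) (subterms s \<union> subterms t)"

definition simple :: "'x sbterm \<Rightarrow> bool" where
  "simple s \<longleftrightarrow> s = Zero \<or>
     (Zero \<notin> subterms s \<and> (\<forall>u. Times One u \<notin> subterms s \<and> Times u One \<notin> subterms s))"

definition ST :: "'x set \<Rightarrow> 'x sbterm set" where
  "ST X = {s \<in> terms_over X. simple s}"

section \<open>Equality modulo AC\<close>

inductive ac_rule :: "'x sbterm \<Rightarrow> 'x sbterm \<Rightarrow> bool" where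
  plus_assoc: "ac_rule (Plus a (Plus b c)) (Plus (Plus a b) c)"
| plus_comm: "ac_rule (Plus a b) (Plus b a)"
| times_assoc: "ac_rule (Times a (Times b c)) (Times (Times a b) c)"

inductive ac_step :: "'x sbterm \<Rightarrow> 'x sbterm \<Rightarrow> bool" where
  left_to_right: "ac_rule s t \<Longrightarrow> ac_step s t"
| right_to_left: "ac_rule t s \<Longrightarrow> ac_step s t"
| in_plus_left: "ac_step s s' \<Longrightarrow> ac_step (Plus s t) (Plus s' t)"
| in_plus_right: "ac_step t t' \<Longrightarrow> ac_step (Plus s t) (Plus s t')"
| in_times_left: "ac_step s s' \<Longrightarrow> ac_step (Times s t) (Times s' t)"
| in_times_right: "ac_step t t' \<Longrightarrow> ac_step (Times s t) (Times s t')"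

definition ac_rel :: "'x set \<Rightarrow> 'x sbterm rel" where
  "ac_rel X = {(s, t). s \<in> ST X \<and> t \<in> ST X \<and> ac_step\<^sup>*\<^sup>* s t}"

definition ac_class :: "'x set \<Rightarrow> 'x sbterm \<Rightarrow> 'x sbterm set" where
  "ac_class X s = ac_rel X `` {s}"

section \<open>The algebra of classes of simple terms\<close>

text \<open>As usual for quotients, an operation on classes is the union over all
  representatives; the lemmas below show that it does not depend on their choice.\<close>

definition nsb_add :: "'x set \<Rightarrow> 'x sbterm set \<Rightarrow> 'x sbterm set \<Rightarrow> 'x sbterm set" where
  "nsb_add X p q =
     (if p = ac_class X Zero then q
      else if q = ac_class X Zero then p
      else (\<Union>s\<in>p. \<Union>t\<in>q. ac_class X (Plus s t)))"

definition nsb_mult :: "'x set \<Rightarrow> 'x sbterm set \<Rightarrow> 'x sbterm set \<Rightarrow> 'x sbterm set" where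
  "nsb_mult X p q =
     (if p = ac_class X Zero \<or> q = ac_class X Zero then ac_class X Zero
      else if p = ac_class X One then q
      else if q = ac_class X One then p
      else (\<Union>s\<in>p. \<Union>t\<in>q. ac_class X (Times s t)))"

definition Nsb :: "'x set \<Rightarrow> 'x sbterm set ring" where
  "Nsb X = \<lparr>carrier = ST X // ac_rel X, mult = nsb_mult X, one = ac_class X One,
            zero = ac_class X Zero, add = nsb_add X\<rparr>"

lemma ac_step_sym: "ac_step s t \<Longrightarrow> ac_step t s"
  by (induction rule: ac_step.induct) (auto intro: ac_step.intros)

lemma ac_steps_sym: "ac_step\<^sup>*\<^sup>* s t \<Longrightarrow> ac_step\<^sup>*\<^sup>* t s"
  by (induction rule: rtranclp_induct) (auto dest: ac_step_sym intro: converse_rtranclp_into_rtranclp)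

lemma equiv_ac_rel: "equiv (ST X) (ac_rel X)"
  by (rule equivI)
     (auto simp: ac_rel_def refl_on_def sym_def trans_def intro: ac_steps_sym)

lemma ac_steps_Plus: "ac_step\<^sup>*\<^sup>* s s' \<Longrightarrow> ac_step\<^sup>*\<^sup>* t t' \<Longrightarrow> ac_step\<^sup>*\<^sup>* (Plus s t) (Plus s' t')"
proof -
  assume s: "ac_step\<^sup>*\<^sup>* s s'" and t: "ac_step\<^sup>*\<^sup>* t t'"
  from s have "ac_step\<^sup>*\<^sup>* (Plus s t) (Plus s' t)"
    by induction (auto intro: ac_step.intros rtranclp.rtrancl_into_rtrancl)
  also from t have "ac_step\<^sup>*\<^sup>* (Plus s' t) (Plus s' t')"
    by induction (auto intro: ac_step.intros rtranclp.rtrancl_into_rtrancl)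
  finally show ?thesis .
qed

lemma ac_steps_Times: "ac_step\<^sup>*\<^sup>* s s' \<Longrightarrow> ac_step\<^sup>*\<^sup>* t t' \<Longrightarrow> ac_step\<^sup>*\<^sup>* (Times s t) (Times s' t')"
proof -
  assume s: "ac_step\<^sup>*\<^sup>* s s'" and t: "ac_step\<^sup>*\<^sup>* t t'"
  from s have "ac_step\<^sup>*\<^sup>* (Times s t) (Times s' t)"
    by induction (auto intro: ac_step.intros rtranclp.rtrancl_into_rtrancl)
  also from t have "ac_step\<^sup>*\<^sup>* (Times s' t) (Times s' t')"
    by induction (auto intro: ac_step.intros rtranclp.rtrancl_into_rtrancl)
  finally show ?thesis .
qed

lemma ST_Plus: "s \<in> ST X \<Longrightarrow> t \<in> ST X \<Longrightarrow> s \<noteq> Zero \<Longrightarrow> t \<noteq> Zero \<Longrightarrow> Plus s t \<in> ST X"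
  by (auto simp: ST_def simple_def terms_over_def)

lemma ST_Times:
  "s \<in> ST X \<Longrightarrow> t \<in> ST X \<Longrightarrow> s \<notin> {Zero, One} \<Longrightarrow> t \<notin> {Zero, One} \<Longrightarrow> Times s t \<in> ST X"
  by (auto simp: ST_def simple_def terms_over_def)

lemma ST_consts: "Zero \<in> ST X" "One \<in> ST X"
  by (auto simp: ST_def simple_def terms_over_def)

lemma ac_step_const: "ac_step s t \<Longrightarrow> s \<notin> {Zero, One} \<and> t \<notin> {Zero, One}"
  by (induction rule: ac_step.induct) (auto elim: ac_rule.cases)

lemma ac_steps_const: "ac_step\<^sup>*\<^sup>* s t \<Longrightarrow> s \<in> {Zero, One} \<or> t \<in> {Zero, One} \<Longrightarrow> s = t"
  by (induction rule: rtranclp_induct) (auto dest: ac_step_const)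

lemma ac_class_eq_iff:
  "s \<in> ST X \<Longrightarrow> t \<in> ST X \<Longrightarrow> ac_class X s = ac_class X t \<longleftrightarrow> ac_step\<^sup>*\<^sup>* s t"
  unfolding ac_class_def by (subst eq_equiv_class_iff[OF equiv_ac_rel]) (auto simp: ac_rel_def)

lemma mem_ac_class: "t \<in> ac_class X s \<longleftrightarrow> s \<in> ST X \<and> t \<in> ST X \<and> ac_step\<^sup>*\<^sup>* s t"
  by (auto simp: ac_class_def ac_rel_def)

lemma ac_class_const_iff:
  assumes "s \<in> ST X" "c \<in> {Zero, One}"
  shows "ac_class X s = ac_class X c \<longleftrightarrow> s = c"
proof -
  have "c \<in> ST X" using assms ST_consts by auto
  then show ?thesis using assms by (auto simp: ac_class_eq_iff dest: ac_steps_const)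
qed

lemma nsb_add_class:
  assumes "s \<in> ST X" "t \<in> ST X" "s \<noteq> Zero" "t \<noteq> Zero"
  shows "ac_class X s \<oplus>\<^bsub>Nsb X\<^esub> ac_class X t = ac_class X (Plus s t)"
proof -
  have "ac_class X (Plus s' t') = ac_class X (Plus s t)"
    if "s' \<in> ac_class X s" "t' \<in> ac_class X t" for s' t'
  proof -
    have *: "s' \<in> ST X" "t' \<in> ST X" "ac_step\<^sup>*\<^sup>* s s'" "ac_step\<^sup>*\<^sup>* t t'"
      using that by (auto simp: mem_ac_class)
    moreover have "s' \<noteq> Zero" "t' \<noteq> Zero" using * ac_steps_const assms(3,4) by blast+
    ultimately have "Plus s t \<in> ST X" "Plus s' t' \<in> ST X" "ac_step\<^sup>*\<^sup>* (Plus s' t') (Plus s t)"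
      using assms by (blast intro: ST_Plus ac_steps_Plus ac_steps_sym)+
    then show ?thesis
      by (simp add: ac_class_eq_iff)
  qed
  moreover have "s \<in> ac_class X s" "t \<in> ac_class X t" using assms by (auto simp: mem_ac_class)
  ultimately have "(\<Union>s'\<in>ac_class X s. \<Union>t'\<in>ac_class X t. ac_class X (Plus s' t')) =
      ac_class X (Plus s t)"
    by blast
  then show ?thesis
    using assms by (simp add: Nsb_def nsb_add_def ac_class_const_iff)
qed

lemma nsb_mult_class:
  assumes "s \<in> ST X" "t \<in> ST X" "s \<notin> {Zero, One}" "t \<notin> {Zero, One}"
  shows "ac_class X s \<otimes>\<^bsub>Nsb X\<^esub> ac_class X t = ac_class X (Times s t)"
proof -
  have "ac_class X (Times s' t') = ac_class X (Times s t)"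
    if "s' \<in> ac_class X s" "t' \<in> ac_class X t" for s' t'
  proof -
    have *: "s' \<in> ST X" "t' \<in> ST X" "ac_step\<^sup>*\<^sup>* s s'" "ac_step\<^sup>*\<^sup>* t t'"
      using that by (auto simp: mem_ac_class)
    moreover have "s' \<notin> {Zero, One}" "t' \<notin> {Zero, One}" using * ac_steps_const assms(3,4) by blast+
    ultimately have "Times s t \<in> ST X" "Times s' t' \<in> ST X" "ac_step\<^sup>*\<^sup>* (Times s' t') (Times s t)"
      using assms by (blast intro: ST_Times ac_steps_Times ac_steps_sym)+
    then show ?thesis
      by (simp add: ac_class_eq_iff)
  qed
  moreover have "s \<in> ac_class X s" "t \<in> ac_class X t" using assms by (auto simp: mem_ac_class)
  ultimately have "(\<Union>s'\<in>ac_class X s. \<Union>t'\<in>ac_class X t. ac_class X (Times s' t')) =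
      ac_class X (Times s t)"
    by blast
  then show ?thesis
    using assms by (simp add: Nsb_def nsb_mult_def ac_class_const_iff)
qed

end

theory Submission
  imports Defs
begin

text \<open>The unit and annihilation laws of strong bimonoids rewrite every term to a simple one, and the
  remaining laws are exactly the AC rules; so the classes of simple terms stand for the terms
  modulo all the laws, which form the free algebra.

  To avoid reasoning about the exceptional cases of the operations again and again, the proof
  works with operations \<open>plus_norm\<close> and \<open>times_norm\<close> on simple terms that apply the unit
  and annihilation laws on the spot. The operations of \<^term>\<open>Nsb X\<close> are these two
  operations on representatives (\<open>nsb_add_norm\<close>, \<open>nsb_mult_norm\<close>), so each law of a strong
  bimonoid reduces to an AC equality in which constants are the only special cases.

  Generation is an induction on simple terms: the arguments of a compound simple term are simple
  and are not the constants on which the operation of \<^term>\<open>Nsb X\<close> behaves exceptionally.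

  For the extension property, a map \<open>f\<close> on the classes of variables is an assignment of the
  variables, \<open>x \<mapsto> f [x]\<close>. Evaluation of terms in the target algebra under this assignment
  is invariant under the AC rules (\<open>sb_eval_ac_steps\<close>), since these are laws of strong bimonoids,
  and hence it defines a map on classes. It is a homomorphism because evaluation turns
  \<open>plus_norm\<close> and \<open>times_norm\<close> into the operations of the target, by the unit and
  annihilation laws there.\<close>

section \<open>Normalizing operations on simple terms\<close>

definition plus_norm :: "'x sbterm \<Rightarrow> 'x sbterm \<Rightarrow> 'x sbterm" where
  "plus_norm s t = (if s = Zero then t else if t = Zero then s else Plus s t)"

definition times_norm :: "'x sbterm \<Rightarrow> 'x sbterm \<Rightarrow> 'x sbterm" where
  "times_norm s t =
     (if s = Zero \<or> t = Zero then Zero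
      else if s = One then t
      else if t = One then s
      else Times s t)"

lemma plus_norm_in_ST: "s \<in> ST X \<Longrightarrow> t \<in> ST X \<Longrightarrow> plus_norm s t \<in> ST X"
  by (simp add: plus_norm_def ST_Plus)

lemma times_norm_in_ST: "s \<in> ST X \<Longrightarrow> t \<in> ST X \<Longrightarrow> times_norm s t \<in> ST X"
  by (simp add: times_norm_def ST_Times ST_consts)

lemma plus_norm_assoc: "ac_step\<^sup>*\<^sup>* (plus_norm (plus_norm s t) u) (plus_norm s (plus_norm t u))"
  by (auto simp: plus_norm_def intro!: r_into_rtranclp ac_step.right_to_left ac_rule.plus_assoc)

lemma plus_norm_comm: "ac_step\<^sup>*\<^sup>* (plus_norm s t) (plus_norm t s)"
  by (auto simp: plus_norm_def intro!: r_into_rtranclp ac_step.left_to_right ac_rule.plus_comm)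

lemma times_norm_assoc:
  "ac_step\<^sup>*\<^sup>* (times_norm (times_norm s t) u) (times_norm s (times_norm t u))"
  by (auto simp: times_norm_def intro!: r_into_rtranclp ac_step.right_to_left ac_rule.times_assoc)

lemma ac_class_in_Nsb: "s \<in> ST X \<Longrightarrow> ac_class X s \<in> carrier (Nsb X)"
  by (simp add: Nsb_def ac_class_def quotientI)

lemma Nsb_carrierE:
  assumes "p \<in> carrier (Nsb X)"
  obtains s where "s \<in> ST X" "p = ac_class X s"
  using assms by (auto simp: Nsb_def ac_class_def elim: quotientE)

lemma zero_Nsb: "\<zero>\<^bsub>Nsb X\<^esub> = ac_class X Zero"
  and one_Nsb: "\<one>\<^bsub>Nsb X\<^esub> = ac_class X One"
  by (simp_all add: Nsb_def)

lemma nsb_add_norm: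
  assumes "s \<in> ST X" "t \<in> ST X"
  shows "ac_class X s \<oplus>\<^bsub>Nsb X\<^esub> ac_class X t = ac_class X (plus_norm s t)"
proof (cases "s = Zero \<or> t = Zero")
  case True
  then show ?thesis
    using assms by (auto simp: plus_norm_def Nsb_def nsb_add_def)
next
  case False
  then show ?thesis
    using assms by (simp add: plus_norm_def nsb_add_class)
qed

lemma nsb_mult_norm:
  assumes "s \<in> ST X" "t \<in> ST X"
  shows "ac_class X s \<otimes>\<^bsub>Nsb X\<^esub> ac_class X t = ac_class X (times_norm s t)"
proof (cases "s \<in> {Zero, One} \<or> t \<in> {Zero, One}")
  case True
  then show ?thesis
    using assms ac_class_const_iff[of s X Zero] ac_class_const_iff[of s X One]
      ac_class_const_iff[of t X Zero] ac_class_const_iff[of t X One]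
    by (auto simp: times_norm_def Nsb_def nsb_mult_def)
next
  case False
  then show ?thesis
    using assms by (simp add: times_norm_def nsb_mult_class)
qed

section \<open>The strong bimonoid laws\<close>

lemma strong_bimonoid_Nsb: "strong_bimonoid (Nsb X)"
proof (intro strong_bimonoid.intro strong_bimonoid_axioms.intro abelian_monoidI monoidI)
  fix p q r
  assume "p \<in> carrier (Nsb X)" "q \<in> carrier (Nsb X)" "r \<in> carrier (Nsb X)"
  then obtain s t u where stu: "s \<in> ST X" "t \<in> ST X" "u \<in> ST X"
      "p = ac_class X s" "q = ac_class X t" "r = ac_class X u"
    by (metis Nsb_carrierE)
  show "(p \<oplus>\<^bsub>Nsb X\<^esub> q) \<oplus>\<^bsub>Nsb X\<^esub> r = p \<oplus>\<^bsub>Nsb X\<^esub> (q \<oplus>\<^bsub>Nsb X\<^esub> r)"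
    using stu by (simp add: nsb_add_norm plus_norm_in_ST ac_class_eq_iff plus_norm_assoc)
  show "(p \<otimes>\<^bsub>Nsb X\<^esub> q) \<otimes>\<^bsub>Nsb X\<^esub> r = p \<otimes>\<^bsub>Nsb X\<^esub> (q \<otimes>\<^bsub>Nsb X\<^esub> r)"
    using stu by (simp add: nsb_mult_norm times_norm_in_ST ac_class_eq_iff times_norm_assoc)
next
  fix p q
  assume "p \<in> carrier (Nsb X)" "q \<in> carrier (Nsb X)"
  then obtain s t where st: "s \<in> ST X" "t \<in> ST X" "p = ac_class X s" "q = ac_class X t"
    by (metis Nsb_carrierE)
  show "p \<oplus>\<^bsub>Nsb X\<^esub> q \<in> carrier (Nsb X)"
    using st by (simp add: nsb_add_norm plus_norm_in_ST ac_class_in_Nsb)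
  show "p \<otimes>\<^bsub>Nsb X\<^esub> q \<in> carrier (Nsb X)"
    using st by (simp add: nsb_mult_norm times_norm_in_ST ac_class_in_Nsb)
  show "p \<oplus>\<^bsub>Nsb X\<^esub> q = q \<oplus>\<^bsub>Nsb X\<^esub> p"
    using st by (simp add: nsb_add_norm plus_norm_in_ST ac_class_eq_iff plus_norm_comm)
next
  fix p
  assume p: "p \<in> carrier (Nsb X)"
  then obtain s where s: "s \<in> ST X" "p = ac_class X s"
    by (rule Nsb_carrierE)
  show "\<zero>\<^bsub>Nsb X\<^esub> \<oplus>\<^bsub>Nsb X\<^esub> p = p"
    using s by (simp add: zero_Nsb nsb_add_norm ST_consts plus_norm_def)
  show "\<one>\<^bsub>Nsb X\<^esub> \<otimes>\<^bsub>Nsb X\<^esub> p = p" "p \<otimes>\<^bsub>Nsb X\<^esub> \<one>\<^bsub>Nsb X\<^esub> = p"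
    using s by (auto simp: one_Nsb nsb_mult_norm ST_consts times_norm_def)
  show "\<zero>\<^bsub>Nsb X\<^esub> \<otimes>\<^bsub>Nsb X\<^esub> p = \<zero>\<^bsub>Nsb X\<^esub>" "p \<otimes>\<^bsub>Nsb X\<^esub> \<zero>\<^bsub>Nsb X\<^esub> = \<zero>\<^bsub>Nsb X\<^esub>"
    using s by (simp_all add: zero_Nsb nsb_mult_norm ST_consts times_norm_def)
qed (simp_all add: zero_Nsb one_Nsb ac_class_in_Nsb ST_consts)

section \<open>Generation by the classes of variables\<close>

lemma Var_in_ST: "Var x \<in> ST X \<longleftrightarrow> x \<in> X"
  by (auto simp: ST_def simple_def terms_over_def)

lemma subterms_refl: "s \<in> subterms s"
  by (cases s) auto

lemma ST_PlusD:
  assumes "Plus s t \<in> ST X"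
  shows "s \<in> ST X" "t \<in> ST X" "s \<noteq> Zero" "t \<noteq> Zero"
  using assms subterms_refl[of s] subterms_refl[of t]
  by (auto simp: ST_def simple_def terms_over_def)

lemma ST_TimesD:
  assumes "Times s t \<in> ST X"
  shows "s \<in> ST X" "t \<in> ST X" "s \<notin> {Zero, One}" "t \<notin> {Zero, One}"
  using assms subterms_refl[of s] subterms_refl[of t]
  by (auto simp: ST_def simple_def terms_over_def)

lemma sb_generate_subset:
  assumes "strong_bimonoid R" "Y \<subseteq> carrier R"
  shows "sb_generate R Y \<subseteq> carrier R"
proof
  interpret strong_bimonoid R by fact
  fix p
  assume "p \<in> sb_generate R Y"
  then show "p \<in> carrier R"
    by induction (use assms(2) in auto)
qed

lemma ac_class_generated:
  "s \<in> ST X \<Longrightarrow> ac_class X s \<in> sb_generate (Nsb X) {ac_class X (Var x) | x. x \<in> X}"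
proof (induction s)
  case (Var x)
  then show ?case
    by (intro sb_generate.gen) (auto simp: Var_in_ST)
next
  case Zero
  show ?case
    using sb_generate.zero[of "Nsb X"] by (simp add: zero_Nsb)
next
  case One
  show ?case
    using sb_generate.one[of "Nsb X"] by (simp add: one_Nsb)
next
  case (Plus s t)
  note st = ST_PlusD[OF Plus.prems]
  show ?case
    using sb_generate.add[OF Plus.IH(1)[OF st(1)] Plus.IH(2)[OF st(2)]]
    by (simp add: nsb_add_class[OF st])
next
  case (Times s t)
  note st = ST_TimesD[OF Times.prems]
  show ?case
    using sb_generate.mult[OF Times.IH(1)[OF st(1)] Times.IH(2)[OF st(2)]]
    by (simp add: nsb_mult_class[OF st])
qed

lemma sb_generate_Nsb: "sb_generate (Nsb X) {ac_class X (Var x) | x. x \<in> X} = carrier (Nsb X)"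
proof
  show "sb_generate (Nsb X) {ac_class X (Var x) | x. x \<in> X} \<subseteq> carrier (Nsb X)"
    by (rule sb_generate_subset[OF strong_bimonoid_Nsb]) (auto simp: ac_class_in_Nsb Var_in_ST)
  show "carrier (Nsb X) \<subseteq> sb_generate (Nsb X) {ac_class X (Var x) | x. x \<in> X}"
    by (auto elim: Nsb_carrierE intro: ac_class_generated)
qed

section \<open>Evaluation of terms\<close>

primrec sb_eval :: "('c, 'm) ring_scheme \<Rightarrow> ('x \<Rightarrow> 'c) \<Rightarrow> 'x sbterm \<Rightarrow> 'c" where
  "sb_eval R g (Var x) = g x"
| "sb_eval R g Zero = \<zero>\<^bsub>R\<^esub>"
| "sb_eval R g One = \<one>\<^bsub>R\<^esub>"
| "sb_eval R g (Plus s t) = sb_eval R g s \<oplus>\<^bsub>R\<^esub> sb_eval R g t"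
| "sb_eval R g (Times s t) = sb_eval R g s \<otimes>\<^bsub>R\<^esub> sb_eval R g t"

lemma ac_rule_vars: "ac_rule s t \<Longrightarrow> vars s = vars t"
  by (induction rule: ac_rule.induct) auto

lemma ac_step_vars: "ac_step s t \<Longrightarrow> vars s = vars t"
  by (induction rule: ac_step.induct) (auto dest: ac_rule_vars)

context strong_bimonoid
begin

lemma sb_eval_closed: "g ` vars s \<subseteq> carrier R \<Longrightarrow> sb_eval R g s \<in> carrier R"
  by (induction s) auto

lemma sb_eval_ac_rule:
  "ac_rule s t \<Longrightarrow> g ` vars s \<subseteq> carrier R \<Longrightarrow> sb_eval R g s = sb_eval R g t"
  by (induction rule: ac_rule.induct)
    (simp_all add: image_Un sb_eval_closed a_ac m_assoc)

lemma sb_eval_ac_step: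
  "ac_step s t \<Longrightarrow> g ` vars s \<subseteq> carrier R \<Longrightarrow> sb_eval R g s = sb_eval R g t"
proof (induction rule: ac_step.induct)
  case (right_to_left t s)
  then show ?case
    using sb_eval_ac_rule[of t s g] by (simp add: ac_rule_vars)
qed (simp_all add: image_Un sb_eval_ac_rule)

text \<open>The AC rules are guaranteed only for values in the carrier of the algebra. That the
  variables keep their values there along a rewriting sequence follows from \<open>ac_step_vars\<close>.\<close>

lemma sb_eval_ac_steps:
  assumes "ac_step\<^sup>*\<^sup>* s t" "g ` vars s \<subseteq> carrier R"
  shows "sb_eval R g s = sb_eval R g t"
proof -
  have "vars s = vars t \<and> sb_eval R g s = sb_eval R g t"
    using assms by induction (simp_all add: ac_step_vars sb_eval_ac_step)
  then show ?thesis ..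
qed

lemma sb_eval_plus_norm:
  assumes "g ` vars s \<subseteq> carrier R" "g ` vars t \<subseteq> carrier R"
  shows "sb_eval R g (plus_norm s t) = sb_eval R g s \<oplus> sb_eval R g t"
  using assms by (auto simp: plus_norm_def sb_eval_closed)

lemma sb_eval_times_norm:
  assumes "g ` vars s \<subseteq> carrier R" "g ` vars t \<subseteq> carrier R"
  shows "sb_eval R g (times_norm s t) = sb_eval R g s \<otimes> sb_eval R g t"
  using assms by (auto simp: times_norm_def sb_eval_closed zero_mult mult_zero)

lemma Nsb_extension:
  assumes g: "g \<in> X \<rightarrow> carrier R"
  shows "\<exists>h \<in> sb_hom (Nsb X) R. \<forall>x\<in>X. h (ac_class X (Var x)) = g x"
proof -
  have vars: "g ` vars s \<subseteq> carrier R" if "s \<in> ST X" for s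
    using that g by (auto simp: ST_def terms_over_def)
  define h where "h p = sb_eval R g (SOME s. s \<in> p)" for p
  have h_class: "h (ac_class X s) = sb_eval R g s" if "s \<in> ST X" for s
  proof -
    have "s \<in> ac_class X s"
      using that by (simp add: mem_ac_class)
    then have "(SOME t. t \<in> ac_class X s) \<in> ac_class X s"
      by (rule someI)
    then show ?thesis
      unfolding h_def by (metis mem_ac_class sb_eval_ac_steps vars)
  qed
  have "h \<in> sb_hom (Nsb X) R"
    unfolding sb_hom_def
  proof (intro CollectI conjI ring_hom_memI)
    fix p
    assume "p \<in> carrier (Nsb X)"
    then show "h p \<in> carrier R"
      by (auto elim!: Nsb_carrierE simp: h_class sb_eval_closed vars)
  next
    fix p q
    assume pq: "p \<in> carrier (Nsb X)" "q \<in> carrier (Nsb X)"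
    show "h (p \<otimes>\<^bsub>Nsb X\<^esub> q) = h p \<otimes> h q"
      using pq by (auto elim!: Nsb_carrierE
          simp: nsb_mult_norm times_norm_in_ST h_class sb_eval_times_norm vars)
    show "h (p \<oplus>\<^bsub>Nsb X\<^esub> q) = h p \<oplus> h q"
      using pq by (auto elim!: Nsb_carrierE
          simp: nsb_add_norm plus_norm_in_ST h_class sb_eval_plus_norm vars)
  qed (simp_all add: zero_Nsb one_Nsb h_class ST_consts)
  moreover have "\<forall>x\<in>X. h (ac_class X (Var x)) = g x"
    by (simp add: h_class Var_in_ST)
  ultimately show ?thesis
    by blast
qed

end

section \<open>Freeness\<close>

theorem theorem5p1:
  fixes X :: "'x set"
  assumes "X \<noteq> {}"
  shows "strong_bimonoid (Nsb X) \<and>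
         freely_generated_in (strong_bimonoid :: 'c ring \<Rightarrow> bool) (Nsb X) {ac_class X (Var x) | x. x \<in> X}"
proof
  show "strong_bimonoid (Nsb X)"
    by (rule strong_bimonoid_Nsb)
  show "freely_generated_in (strong_bimonoid :: 'c ring \<Rightarrow> bool) (Nsb X)
      {ac_class X (Var x) | x. x \<in> X}"
    unfolding freely_generated_in_def
  proof (intro conjI allI impI)
    show "{ac_class X (Var x) | x. x \<in> X} \<subseteq> carrier (Nsb X)"
      by (auto simp: ac_class_in_Nsb Var_in_ST)
    show "sb_generate (Nsb X) {ac_class X (Var x) | x. x \<in> X} = carrier (Nsb X)"
      by (rule sb_generate_Nsb)
  next
    fix A :: "'c ring" and f
    assume A: "strong_bimonoid A" and f: "f \<in> {ac_class X (Var x) | x. x \<in> X} \<rightarrow> carrier A"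
    from f have "(\<lambda>x. f (ac_class X (Var x))) \<in> X \<rightarrow> carrier A"
      by blast
    from strong_bimonoid.Nsb_extension[OF A this]
    show "\<exists>h \<in> sb_hom (Nsb X) A. \<forall>y \<in> {ac_class X (Var x) | x. x \<in> X}. h y = f y"
      by blast
  qed
qed

end
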